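(* For every coloring $c:\mathbf{N}\to\{0,1\}$ there exist an infinite apart set $H$ of positive integers and integers $a,b>0$ such that the set $FS^{\{a,\,a+b,\,a+2b\}\cup\{b\}}(H)$ is monochromatic under $c$ (i.e. $c$ is constant on it).
   Context: $\mathbf{N}$ is the set of natural numbers. For a positive integer $n=2^{t_1}+\dots+2^{t_k}$ with $t_1<\dots<t_k$ let $\lambda(n)=t_1$ and $\mu(n)=t_k$. A set $X$ of positive integers is apart (satisfies the Apartness Condition) if for all $x,x'\in X$ with $x<x'$ we have $\mu(x)<\lambda(x')$. For a set $A$ of positive integers and a set $B\subseteq\mathbf{N}$, $FS^{A}(B)$ denotes the set of all sums of exactly $j$ distinct elements of $B$, for all $j\in A$. *)

theory Defs
  imports Main "HOL-Library.Nat_Bijection"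
begin

(* set_decode n is the set of exponents in the binary expansion of n:
   n = (\<Sum>t\<in>set_decode n. 2 ^ t), see set_encode_def and set_decode_inverse.
   The values at 0 are unspecified (Min and Max of the empty set). *)

definition lambda_exp :: "nat \<Rightarrow> nat" where
  "lambda_exp n = Min (set_decode n)"

definition mu_exp :: "nat \<Rightarrow> nat" where
  "mu_exp n = Max (set_decode n)"

(* Meant for sets of positive integers. *)
definition apart :: "nat set \<Rightarrow> bool" where
  "apart X \<longleftrightarrow> (\<forall>x\<in>X. \<forall>x'\<in>X. x < x' \<longrightarrow> mu_exp x < lambda_exp x')"

(* Finiteness of F matters only when 0 \<in> A, as infinite sets have card 0. *)
definition FS :: "nat set \<Rightarrow> nat set \<Rightarrow> nat set" where
  "FS A B = {\<Sum>F | F. F \<subseteq> B \<and> finite F \<and> card F \<in> A}"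

definition monochromatic :: "(nat \<Rightarrow> 'c) \<Rightarrow> nat set \<Rightarrow> bool" where
  "monochromatic c S \<longleftrightarrow> (\<exists>k. \<forall>s\<in>S. c s = k)"

lemma exponents_unique:
  assumes "finite T" and "n = (\<Sum>t\<in>T. 2 ^ t)"
  shows "lambda_exp n = Min T" and "mu_exp n = Max T"
proof -
  have "set_decode n = T"
    using assms set_encode_inverse[of T] by (simp add: set_encode_def)
  then show "lambda_exp n = Min T" and "mu_exp n = Max T"
    by (simp_all add: lambda_exp_def mu_exp_def)
qed

end

theory Submission
  imports "HOL-Library.Ramsey" Defs
begin

text \<open>Ramsey's theorem, applied to the sets of powers of two of each size \<open>j \<le> 17\<close>, yields an
  infinite set of powers of two on which the colour of a \<open>j\<close>-fold sum depends only on \<open>j\<close>. This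
  gives a 2-colouring of \<open>{1..17}\<close>, and every such colouring has a monochromatic arithmetic
  progression of length 3 together with its difference.\<close>

text \<open>Induction on \<open>N\<close>: Ramsey's theorem for sets of size \<open>Suc N\<close>
  shrinks the set found so far, and the colours \<open>d\<close> of the smaller sizes survive in any
  subset.\<close>

lemma Ramsey_simultaneous:
  fixes f :: "'a set \<Rightarrow> nat"
  assumes "infinite Z" and "\<And>X. f X < s"
  shows "\<exists>Y d. Y \<subseteq> Z \<and> infinite Y \<and>
           (\<forall>X. X \<subseteq> Y \<and> finite X \<and> card X \<le> N \<longrightarrow> f X = d (card X))"
proof (induction N)
  case 0
  show ?case
    \<comment> \<open>A finite \<open>X\<close> with \<open>card X \<le> 0\<close> is empty.\<close>
    using assms(1) by (intro exI[of _ Z] exI[of _ "\<lambda>_. f {}"]) auto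
next
  case (Suc N)
  then obtain Y d where Y: "Y \<subseteq> Z" "infinite Y"
    and d: "\<And>X. X \<subseteq> Y \<Longrightarrow> finite X \<Longrightarrow> card X \<le> N \<Longrightarrow> f X = d (card X)"
    by blast
  have "\<exists>Y' t. Y' \<subseteq> Y \<and> infinite Y' \<and> t < s \<and>
      (\<forall>X. X \<subseteq> Y' \<and> finite X \<and> card X = Suc N \<longrightarrow> f X = t)"
    using Y(2) assms(2) by (intro Ramsey) simp_all
  then obtain Y' t where Y': "Y' \<subseteq> Y" "infinite Y'"
    and t: "\<And>X. X \<subseteq> Y' \<Longrightarrow> finite X \<Longrightarrow> card X = Suc N \<Longrightarrow> f X = t"
    by metis
  have "f X = (d(Suc N := t)) (card X)"
    if "X \<subseteq> Y'" "finite X" "card X \<le> Suc N" for X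
    using that d[of X] t[of X] Y'(1) by (cases "card X = Suc N") auto
  with Y Y' show ?case
    by (intro exI[of _ Y'] exI[of _ "d(Suc N := t)"]) auto
qed

text \<open>Two-colour case of Brauer's theorem for progressions of length 3. The colouring is a
  predicate, so that the finite check becomes propositional.\<close>

lemma Brauer_3_2:
  fixes P :: "nat \<Rightarrow> bool"
  shows "\<exists>a b. a > 0 \<and> b > 0 \<and> a + 2 * b \<le> 17 \<and>
           P a = P b \<and> P (a + b) = P b \<and> P (a + 2 * b) = P b"
proof (rule ccontr)
  assume "\<not> ?thesis"
  then have *: "\<not> (P a = P b \<and> P (a + b) = P b \<and> P (a + 2 * b) = P b)"
    if "a > 0" "b > 0" "a + 2 * b \<le> 17" for a b
    using that by blast
  \<comment> \<open>Since \<open>a \<ge> 1\<close>, the bound 17 forces \<open>b \<le> 8\<close>.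
    Explicit lists allow the quantifiers to be unrolled.\<close>
  have "(P b \<or> P a \<or> P (a + b) \<or> P (a + 2 * b)) \<and>
      (\<not> P b \<or> \<not> P a \<or> \<not> P (a + b) \<or> \<not> P (a + 2 * b))"
    if "b \<in> set [1..<9]" "a \<in> set [1..<18 - 2 * b]" for a b
  proof -
    have "a > 0" "b > 0" "a + 2 * b \<le> 17"
      using that by auto
    then show ?thesis
      using *[of a b] by blast
  qed
  then have "\<forall>b\<in>set [1..<9]. \<forall>a\<in>set [1..<18 - 2 * b].
      (P b \<or> P a \<or> P (a + b) \<or> P (a + 2 * b)) \<and>
      (\<not> P b \<or> \<not> P a \<or> \<not> P (a + b) \<or> \<not> P (a + 2 * b))"
    by blast
  \<comment> \<open>Unrolled, this is an unsatisfiable set of clauses in the atoms \<open>P 1, \<dots>, P 17\<close>.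
    Numerals go to \<open>Suc\<close> form so that equal atoms become syntactically equal.\<close>
  then show False
    by (simp add: upt_conv_Cons numeral_eq_Suc del: upt_Suc set_upt, sat)
qed

lemma exps_power_of_two [simp]:
  "lambda_exp (2 ^ i) = i" "mu_exp (2 ^ i) = i"
  using exponents_unique[of "{i}" "2 ^ i"] by simp_all

text \<open>A power of two has a single exponent, so apartness reduces to monotonicity of the
  exponent.\<close>

lemma apart_powers_of_two:
  assumes "H \<subseteq> range ((^) 2)"
  shows "apart H"
  unfolding apart_def
proof (intro ballI impI)
  fix x x' assume "x \<in> H" "x' \<in> H" "x < x'"
  moreover from this assms obtain i j where "x = 2 ^ i" "x' = 2 ^ j"
    by blast
  ultimately show "mu_exp x < lambda_exp x'"
    by simp
qed

theorem theorem2: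
  fixes c :: "nat \<Rightarrow> nat"
  assumes "range c \<subseteq> {0, 1}"
  shows "\<exists>H a b. infinite H \<and> (\<forall>x\<in>H. x > 0) \<and> apart H \<and> a > 0 \<and> b > 0 \<and>
           monochromatic c (FS ({a, a + b, a + 2 * b} \<union> {b}) H)"
proof -
  have c: "c n = 0 \<or> c n = 1" for n
    using assms by auto
  then have "c (\<Sum>X) < 2" for X
    by (metis one_less_numeral_iff semiring_norm(76) zero_less_numeral)
  moreover have "infinite (range ((^) (2::nat)))"
    by (intro range_inj_infinite injI) simp
  ultimately have "\<exists>H d. H \<subseteq> range ((^) 2) \<and> infinite H \<and>
      (\<forall>X. X \<subseteq> H \<and> finite X \<and> card X \<le> 17 \<longrightarrow> c (\<Sum>X) = d (card X))"
    by (intro Ramsey_simultaneous)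
  then obtain H d where H: "H \<subseteq> range ((^) 2)" "infinite H"
    and d: "\<And>X. X \<subseteq> H \<Longrightarrow> finite X \<Longrightarrow> card X \<le> 17 \<Longrightarrow> c (\<Sum>X) = d (card X)"
    by metis
  \<comment> \<open>Each \<open>d j\<close> is a genuine colour, as the infinite set
    \<open>H\<close> has a subset of size \<open>j\<close>.\<close>
  have d01: "d j = 0 \<or> d j = 1" if "j \<le> 17" for j
    using infinite_arbitrarily_large[OF H(2), of j] d c that by metis
  obtain a b where ab: "a > 0" "b > 0" "a + 2 * b \<le> 17"
    and "(d a = 0) = (d b = 0)" "(d (a + b) = 0) = (d b = 0)" "(d (a + 2 * b) = 0) = (d b = 0)"
    using Brauer_3_2[of "\<lambda>j. d j = 0"] by metis
  \<comment> \<open>With only two colours, agreeing on being 0 means being equal.\<close>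
  then have d_eq: "d j = d b" if "j \<in> {a, a + b, a + 2 * b} \<union> {b}" for j
    using that d01[of a] d01[of b] d01[of "a + b"] d01[of "a + 2 * b"] by auto
  have le: "j \<le> 17" if "j \<in> {a, a + b, a + 2 * b} \<union> {b}" for j
    using that ab by auto
  have "c n = d b" if n: "n \<in> FS ({a, a + b, a + 2 * b} \<union> {b}) H" for n
  proof -
    obtain F where "n = \<Sum>F" "F \<subseteq> H" "finite F"
      and F: "card F \<in> {a, a + b, a + 2 * b} \<union> {b}"
      using n unfolding FS_def by blast
    then show ?thesis
      using d[of F] le[OF F] d_eq[OF F] by simp
  qed
  then have "monochromatic c (FS ({a, a + b, a + 2 * b} \<union> {b}) H)"
    unfolding monochromatic_def by blast
  moreover have "\<forall>x\<in>H. x > 0"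
    using H(1) by auto
  ultimately show ?thesis
    using H(2) apart_powers_of_two[OF H(1)] ab(1,2) by blast
qed

end
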